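(* Let $p$ be a prime, $q=p^e>4$, and let $\ell$ be a positive integer with $2\ell\mid e$. Let $\boldsymbol a=(a_1,\ldots,a_n)$ be a vector of pairwise distinct elements of $\mathbb F_q$ and put $u_i=\prod_{1\le j\le n,\,j\ne i}(a_i-a_j)^{-1}$. Assume that $a_i\ne0$ and $a_i^{-1}u_i\in\mathbb F_{p^\ell}^{*}$ for $1\le i\le n$. Let $s\ge 1$ and let $A_s\in\operatorname{GL}_s(\mathbb F_q)$ be arbitrary. Then, for every integer $k$ with $s+1\le k\le\left\lfloor\frac{n+p^\ell}{p^\ell+1}\right\rfloor$ and every integer $h$ with $0\le h\le k-s-1$, there exists an $[n+s,k]_q$ generalized Roth-Lempel code $C$ with extension matrix $A_s$ such that $\dim(\operatorname{Hull}_{\ell}(C))=h$.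
   Context: For $q=p^e$ and $0\le\ell\le e-1$, the $\ell$-Galois inner product on $\mathbb F_q^N$ is $\langle\boldsymbol x,\boldsymbol y\rangle_\ell=\sum_i x_iy_i^{p^\ell}$. For a linear code $C\subseteq\mathbb F_q^N$, $C^{\perp_\ell}=\{\boldsymbol x\in\mathbb F_q^N:\langle\boldsymbol c,\boldsymbol x\rangle_\ell=0\ \text{for all }\boldsymbol c\in C\}$ and $\operatorname{Hull}_\ell(C)=C\cap C^{\perp_\ell}$. Generalized Roth-Lempel (GRL) code: let $1\le s\le k\le n$, let $\boldsymbol a\in\mathbb F_q^n$ have pairwise distinct entries, let $\boldsymbol v\in(\mathbb F_q^* )^n$ and $A_s\in\operatorname{GL}_s(\mathbb F_q)$. Then $\operatorname{GRL}_k(\boldsymbol a,\boldsymbol v,A_s)$ is the $[n+s,k]_q$ linear code $$\{(v_1f(a_1),\ldots,v_nf(a_n),(f_{k-s},\ldots,f_{k-1})A_s): f(x)=\textstyle\sum_{j=0}^{k-1}f_jx^j\in\mathbb F_q[x]\}.$$ The matrix $A_s$ is called its extension matrix. An $[N,k]_q$ code is a $k$-dimensional subspace of $\mathbb F_q^N$. *)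

theory Defs
  imports
    "HOL-Algebra.Subrings"
    "HOL-Computational_Algebra.Polynomial"
    "HOL-Computational_Algebra.Primes"
    "Jordan_Normal_Form.VS_Connect"
begin

(* The field F_q is a finite field type, F_q^N is carrier_vec N, and vectors are indexed
   from 0, so that the paper's a_i is a $ (i - 1). *)

definition galois_inner :: "nat \<Rightarrow> nat \<Rightarrow> 'a::field vec \<Rightarrow> 'a vec \<Rightarrow> 'a" where
  "galois_inner p l x y = (\<Sum>i<dim_vec x. x $ i * (y $ i) ^ (p ^ l))"

definition galois_dual :: "nat \<Rightarrow> nat \<Rightarrow> nat \<Rightarrow> 'a::field vec set \<Rightarrow> 'a vec set" where
  "galois_dual p l N C = {x \<in> carrier_vec N. \<forall>c\<in>C. galois_inner p l c x = 0}"

definition galois_hull :: "nat \<Rightarrow> nat \<Rightarrow> nat \<Rightarrow> 'a::field vec set \<Rightarrow> 'a vec set" where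
  "galois_hull p l N C = C \<inter> galois_dual p l N C"

(* Meaningful only if C is a subspace of F_q^N. *)
definition code_dim :: "nat \<Rightarrow> 'a::field vec set \<Rightarrow> nat" where
  "code_dim N C = vectorspace.dim class_ring ((module_vec TYPE('a) N)\<lparr>carrier := C\<rparr>)"

definition linear_code :: "nat \<Rightarrow> nat \<Rightarrow> 'a::field vec set \<Rightarrow> bool" where
  "linear_code N k C \<longleftrightarrow>
     VectorSpace.subspace class_ring C (module_vec TYPE('a) N) \<and> code_dim N C = k"

definition GL :: "nat \<Rightarrow> 'a::field mat set" where
  "GL s = {A \<in> carrier_mat s s. invertible_mat A}"

definition GRL_params ::
  "nat \<Rightarrow> nat \<Rightarrow> nat \<Rightarrow> 'a::field vec \<Rightarrow> 'a vec \<Rightarrow> 'a mat \<Rightarrow> bool" where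
  "GRL_params n s k a v A \<longleftrightarrow>
     1 \<le> s \<and> s \<le> k \<and> k \<le> n \<and>
     a \<in> carrier_vec n \<and> inj_on (\<lambda>i. a $ i) {..<n} \<and>
     v \<in> carrier_vec n \<and> (\<forall>i<n. v $ i \<noteq> 0) \<and>
     A \<in> GL s"

(* n and s are the dimensions of a and A.  The row vector w A is written as A^T w.
   For k \<ge> 1, "degree f < k" describes the polynomials f_0 + ... + f_{k-1} x^{k-1},
   the zero polynomial (of degree 0 in the library) included. *)
definition GRL :: "nat \<Rightarrow> 'a::field vec \<Rightarrow> 'a vec \<Rightarrow> 'a mat \<Rightarrow> 'a vec set" where
  "GRL k a v A =
     {vec (dim_vec a) (\<lambda>i. v $ i * poly f (a $ i)) @\<^sub>v
        (transpose_mat A *\<^sub>v vec (dim_row A) (\<lambda>j. coeff f (k - dim_row A + j)))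
      | f. degree f < k}"

definition lagrange_u :: "'a::field vec \<Rightarrow> nat \<Rightarrow> 'a" where
  "lagrange_u a i = (\<Prod>j\<in>{..<dim_vec a} - {i}. inverse (a $ i - a $ j))"

end

(* Choose v_i with v_i^(r+1) = u_i / a_i, where r = p^l; this is possible because the norm from
   the quadratic extension of K is onto K.  Evaluating the Lagrange interpolation formula at 0
   gives sum_i (u_i / a_i) P(a_i) = c P(0) with c nonzero whenever deg P < n, and the bound on k
   makes this apply to P = g f^r.  So the Galois form on codewords is c g(0) f(0)^r plus a
   nondegenerate form on the top s coefficients, of rank s + 1.  Multiplying t = k - s - 1 - h of
   the v_i by a scalar alpha with alpha^(r+1) different from 1 adds multiples of g(a_i) f(a_i)^r.
   All the functionals involved are linearly independent, so the hull consists of the codewords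
   of the f that vanish at 0 and at the t chosen a_i and whose top s coefficients are 0. *)

theory Submission
  imports "HOL-Algebra.Multiplicative_Group" Defs
begin

hide_const (open) UnivPoly.coeff UnivPoly.monom

section \<open>Images of injective linear maps\<close>

text \<open>Rank-nullity with trivial kernel. Taking coefficient vectors as the source
  \<open>carrier_vec m\<close>, this serves for the dimension of the code and of its hull
  alike.\<close>

lemma injective_image_subspace_dim:
  fixes T :: "'a::field vec \<Rightarrow> 'a vec"
  assumes closed: "\<And>x. x \<in> carrier_vec m \<Longrightarrow> T x \<in> carrier_vec N"
    and add: "\<And>x y. x \<in> carrier_vec m \<Longrightarrow> y \<in> carrier_vec m \<Longrightarrow> T (x + y) = T x + T y"
    and smult: "\<And>c x. x \<in> carrier_vec m \<Longrightarrow> T (c \<cdot>\<^sub>v x) = c \<cdot>\<^sub>v T x"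
    and inj: "inj_on T (carrier_vec m)"
  shows "VectorSpace.subspace class_ring (T ` carrier_vec m) (module_vec TYPE('a) N)"
    and "code_dim N (T ` carrier_vec m) = m"
proof -
  let ?V = "module_vec TYPE('a) m" and ?W = "module_vec TYPE('a) N"
  interpret V: vec_space "TYPE('a)" m .
  have hom: "T \<in> module_hom class_ring ?V ?W"
    unfolding module_hom_def using closed add smult by (auto simp: module_vec_simps)
  interpret L: linear_map class_ring ?V ?W T
    by (intro linear_map.intro mod_hom.intro mod_hom_axioms.intro vec_vs hom
        vectorspace.axioms(1))
  have im: "L.imT = T ` carrier_vec m"
    unfolding L.im_def by (simp add: module_vec_simps)
  show "VectorSpace.subspace class_ring (T ` carrier_vec m) ?W"
    using L.imT_is_subspace unfolding im .
  have "vectorspace.dim class_ring (?V\<lparr>carrier := L.kerT\<rparr>) = 0"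
    by (rule L.inj_imp_dim_ker0) (simp add: module_vec_simps inj)
  with L.rank_nullity[OF V.fin_dim]
  show "code_dim N (T ` carrier_vec m) = m"
    unfolding code_dim_def im by (simp add: V.dim_is_n)
qed

section \<open>Finite fields\<close>

text \<open>The unit group is cyclic and a generator has order \<open>q - 1\<close>. Going through
  \<open>class_ring\<close> carries this from the algebraic structure over to the type
  class.\<close>

lemma finite_field_generator:
  obtains g :: "'a::{field,finite}" where "g \<noteq> 0" "\<And>x. x \<noteq> 0 \<Longrightarrow> \<exists>i. x = g ^ i"
    "\<And>i. g ^ i = 1 \<longleftrightarrow> card (UNIV :: 'a set) - 1 dvd i"
proof -
  let ?R = "class_ring :: 'a ring"
  have F: "field ?R" by (rule class_field)
  interpret G: group "mult_of ?R" by (rule field.field_mult_group[OF F])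
  have pow: "x [^]\<^bsub>mult_of ?R\<^esub> i = x ^ i" for x and i :: nat
    by (simp add: nat_pow_mult_of class_ring_simps)
  obtain g where g: "g \<in> carrier (mult_of ?R)"
    and "carrier (mult_of ?R) = {g [^]\<^bsub>?R\<^esub> i | i::nat. i \<in> UNIV}"
    using field.finite_field_mult_group_has_gen[OF F] by auto
  then have gen: "carrier (mult_of ?R) = {g [^]\<^bsub>mult_of ?R\<^esub> i | i::nat. i \<in> UNIV}"
    by (simp add: nat_pow_mult_of)
  have "G.ord g = card (carrier (mult_of ?R))"
    using G.generate_pow_card[OF g] G.generate_pow_on_finite_carrier[OF _ g] gen by simp
  then have "G.ord g = card (UNIV :: 'a set) - 1" by (simp add: card_Diff_singleton)
  then have "g ^ i = 1 \<longleftrightarrow> card (UNIV :: 'a set) - 1 dvd i" for i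
    using G.pow_eq_id[OF g, of i] by (simp add: pow)
  moreover have "\<exists>i. x = g ^ i" if "x \<noteq> 0" for x
    using gen that by (auto simp: pow)
  moreover have "g \<noteq> 0" using g by simp
  ultimately show thesis using that by blast
qed

text \<open>Multiplication by \<open>x\<close> permutes \<open>S\<close>, so \<open>\<Prod>S\<close>
  is unchanged when every factor is multiplied by \<open>x\<close>; being nonzero, it cancels. With
  \<open>S\<close> the nonzero elements of a subfield this is Fermat's little theorem.\<close>

lemma power_card_mult_invariant_eq_1:
  fixes x :: "'a::field"
  assumes "finite S" "0 \<notin> S" "x \<noteq> 0" "(*) x ` S \<subseteq> S"
  shows "x ^ card S = 1"
proof -
  have inj: "inj_on ((*) x) S" using \<open>x \<noteq> 0\<close> by (auto simp: inj_on_def)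
  then have "(*) x ` S = S" using assms by (simp add: endo_inj_surj)
  then have "\<Prod>S = (\<Prod>y\<in>S. x * y)" using prod.reindex[OF inj, of id] by simp
  also have "\<dots> = x ^ card S * \<Prod>S" by (simp add: prod.distrib)
  finally show ?thesis using assms(1,2) by (simp add: prod_zero_iff)
qed

lemma subfield_power_card_eq_1:
  fixes K :: "'a::{field,finite} set"
  assumes "subfield K class_ring" "x \<in> K" "x \<noteq> 0"
  shows "x ^ (card K - 1) = 1"
proof -
  have "x * y \<in> K" if "y \<in> K" for y
    using subringE(6)[OF subfieldE(1)[OF assms(1)] \<open>x \<in> K\<close> that] by simp
  then have "(*) x ` (K - {0}) \<subseteq> K - {0}" using \<open>x \<noteq> 0\<close> by auto
  moreover have "0 \<in> K" using subringE(2)[OF subfieldE(1)[OF assms(1)]] by simp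
  ultimately show ?thesis
    using power_card_mult_invariant_eq_1[of "K - {0}" x] \<open>x \<noteq> 0\<close> by simp
qed

lemma minus_one_dvd_power_minus_one: "(x::nat) - 1 dvd x ^ m - 1"
proof (induction m)
  case (Suc m)
  show ?case
  proof (cases x)
    case (Suc y)
    \<comment> \<open>Writing the power as a successor keeps the truncated subtraction exact; the
      remaining case \<open>x = 0\<close> is trivial.\<close>
    then obtain w where "x ^ m = Suc w" by (cases "x ^ m") auto
    then have "x ^ Suc m - 1 = x * (x ^ m - 1) + (x - 1)" by (simp add: Suc)
    then show ?thesis using Suc.IH by simp
  qed simp
qed simp

lemma square_minus_one_dvd_power:
  assumes "2 * l dvd e"
  shows "((p::nat) ^ l - 1) * (p ^ l + 1) dvd p ^ e - 1"
proof -
  obtain m where m: "e = 2 * l * m" using assms by blast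
  have "(p ^ l - 1) * (p ^ l + 1) = p ^ (2 * l) - 1"
    by (cases "p ^ l") (auto simp: power2_eq_square power_mult mult.commute[of 2] algebra_simps)
  then show ?thesis
    using minus_one_dvd_power_minus_one[of "p ^ (2 * l)" m] by (simp add: m power_mult)
qed

text \<open>The map \<open>v \<mapsto> v ^ (r + 1)\<close> with \<open>r = card K\<close> restricts to the norm of the quadratic
  extension of \<open>K\<close>, which is onto \<open>K\<close>.\<close>

lemma ex_root_of_subfield_element:
  fixes K :: "'a::{field,finite} set"
  assumes "subfield K class_ring" "x \<in> K" "x \<noteq> 0"
    and dvd: "(card K - 1) * (card K + 1) dvd card (UNIV :: 'a set) - 1"
    and r: "card K > 1"
  shows "\<exists>v. v \<noteq> 0 \<and> v ^ (card K + 1) = x"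
proof -
  obtain g :: 'a where g: "g \<noteq> 0" "\<And>x. x \<noteq> 0 \<Longrightarrow> \<exists>i. x = g ^ i"
    and ord: "\<And>i. g ^ i = 1 \<longleftrightarrow> card (UNIV :: 'a set) - 1 dvd i"
    using finite_field_generator by blast
  obtain i where i: "x = g ^ i" using g \<open>x \<noteq> 0\<close> by blast
  \<comment> \<open>Hence \<open>q - 1\<close> divides \<open>i * (card K - 1)\<close>. By
    \<open>dvd\<close>, so does \<open>(card K - 1) * (card K + 1)\<close>, and cancelling
    \<open>card K - 1\<close> makes the exponent \<open>i\<close> a multiple of
    \<open>card K + 1\<close>.\<close>
  have "g ^ (i * (card K - 1)) = 1"
    using subfield_power_card_eq_1[OF assms(1-3)] by (simp add: i power_mult)
  then have "(card K - 1) * (card K + 1) dvd (card K - 1) * i"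
    using ord dvd by (metis dvd_trans mult.commute)
  then have "card K + 1 dvd i"
    using nat_mult_dvd_cancel1[of "card K - 1"] r by (metis zero_less_diff)
  then obtain j where "i = j * (card K + 1)" by (metis dvd_def mult.commute)
  then have "(g ^ j) ^ (card K + 1) = x" by (simp only: i power_mult)
  then show ?thesis using \<open>g \<noteq> 0\<close> by (metis power_not_zero)
qed

section \<open>Polynomials\<close>

text \<open>The roots are split off one at a time: the product already found does not vanish at a
  new, distinct root, so the cofactor must.\<close>

lemma prod_linear_dvd:
  fixes f :: "'a::field poly"
  assumes "finite I" "inj_on z I" "\<And>i. i \<in> I \<Longrightarrow> poly f (z i) = 0"
  shows "(\<Prod>i\<in>I. [:- z i, 1:]) dvd f"
  using assms
proof (induction I rule: finite_induct)
  case (insert i I)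
  then obtain g where g: "f = (\<Prod>i\<in>I. [:- z i, 1:]) * g" by (auto simp: dvd_def)
  have "poly (\<Prod>i\<in>I. [:- z i, 1:]) (z i) \<noteq> 0"
    using insert by (auto simp: poly_prod)
  then have "poly g (z i) = 0" using insert.prems(2)[of i] by (auto simp: g)
  then have "[:- z i, 1:] dvd g" by (simp add: poly_eq_0_iff_dvd)
  then have "[:- z i, 1:] * (\<Prod>i\<in>I. [:- z i, 1:]) dvd g * (\<Prod>i\<in>I. [:- z i, 1:])"
    by (intro mult_dvd_mono) auto
  then show ?case
    unfolding prod.insert[OF insert.hyps] g by (simp only: mult.commute)
qed simp

lemma degree_prod_linear: "degree (\<Prod>i\<in>I. [:- z i, 1:] :: 'a::field poly) = card I"
  by (subst degree_prod_sum_eq) auto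

text \<open>Both sides have degree below the number of nodes and agree at all of them: the factor
  \<open>lagrange_u a i\<close> gives the \<open>i\<close>-th node product the value 1 at
  \<open>a $ i\<close>, and that product vanishes at the other nodes.\<close>

lemma lagrange_interpolation:
  fixes a :: "'a::field vec"
  assumes a: "inj_on (\<lambda>i. a $ i) {..<dim_vec a}" and P: "degree P < dim_vec a"
  shows "P = (\<Sum>i<dim_vec a. Polynomial.smult (poly P (a $ i) * lagrange_u a i)
    (\<Prod>j\<in>{..<dim_vec a} - {i}. [:- (a $ j), 1:]))" (is "P = ?L")
proof (rule poly_eqI_degree[of "(\<lambda>i. a $ i) ` {..<dim_vec a}"])
  fix x assume "x \<in> (\<lambda>i. a $ i) ` {..<dim_vec a}"
  then obtain j where j: "j < dim_vec a" "x = a $ j" by auto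
  have 1: "poly (\<Prod>j\<in>{..<dim_vec a} - {i}. [:- (a $ j), 1:]) x = 0"
    if "i < dim_vec a" "i \<noteq> j" for i
    using that j by (auto simp: poly_prod)
  have nz: "a $ j \<noteq> a $ i" if "i \<in> {..<dim_vec a} - {j}" for i
    using that j a by (auto simp: inj_on_def)
  have 2: "lagrange_u a j * poly (\<Prod>i\<in>{..<dim_vec a} - {j}. [:- (a $ i), 1:]) x = 1"
    unfolding lagrange_u_def poly_prod prod.distrib[symmetric]
    using nz by (intro prod.neutral) (auto simp: j)
  have "poly ?L x = (\<Sum>i<dim_vec a. if i = j then poly P (a $ j) else 0)"
    unfolding poly_sum using 1 2 by (intro sum.cong) (auto simp: j(1))
  then show "poly P x = poly ?L x" using j by simp
next
  show "degree P < card ((\<lambda>i. a $ i) ` {..<dim_vec a})" using P a by (simp add: card_image)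
  have "degree ?L < dim_vec a"
    using P by (intro degree_sum_less le_less_trans[OF degree_smult_le])
      (auto simp: degree_prod_linear)
  then show "degree ?L < card ((\<lambda>i. a $ i) ` {..<dim_vec a})" using a by (simp add: card_image)
qed

text \<open>This is the interpolation formula evaluated at 0, which is not a node. It turns the sum
  weighted by \<open>inverse (a $ i) * lagrange_u a i\<close> into a single evaluation
  functional.\<close>

lemma sum_lagrange_u_div:
  fixes a :: "'a::field vec"
  assumes a: "inj_on (\<lambda>i. a $ i) {..<dim_vec a}" and P: "degree P < dim_vec a"
    and nz: "\<forall>i<dim_vec a. a $ i \<noteq> 0"
  shows "(\<Sum>i<dim_vec a. inverse (a $ i) * lagrange_u a i * poly P (a $ i))
    = - inverse (\<Prod>i<dim_vec a. - (a $ i)) * poly P 0"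
proof -
  let ?D = "\<Prod>i<dim_vec a. - (a $ i)"
  have D: "?D \<noteq> 0" using nz by auto
  \<comment> \<open>The value at 0 of the \<open>i\<close>-th node product: the full product with
    its factor \<open>- (a $ i)\<close> divided out.\<close>
  have "(\<Prod>j\<in>{..<dim_vec a} - {i}. - (a $ j)) = - ?D * inverse (a $ i)" if "i < dim_vec a" for i
    using that nz by (subst prod.remove[of "{..<dim_vec a}" i]) (auto simp: field_simps)
  then have "poly P 0 = (\<Sum>i<dim_vec a. - ?D * (inverse (a $ i) * lagrange_u a i * poly P (a $ i)))"
    by (subst lagrange_interpolation[OF a P]) (auto simp: poly_sum poly_prod intro!: sum.cong)
  also have "\<dots> = - ?D * (\<Sum>i<dim_vec a. inverse (a $ i) * lagrange_u a i * poly P (a $ i))"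
    by (simp only: sum_distrib_left)
  finally show ?thesis using D by (simp add: field_simps)
qed

section \<open>Codewords\<close>

lemma GL_transpose_solvable:
  assumes "A \<in> GL s" "y \<in> carrier_vec s"
  obtains x where "x \<in> carrier_vec s" "transpose_mat A *\<^sub>v x = y"
proof -
  obtain B where A: "A \<in> carrier_mat s s" and B: "A * B = 1\<^sub>m (dim_row A)" "B * A = 1\<^sub>m (dim_row B)"
    using assms by (auto simp: GL_def invertible_mat_def inverts_mat_def)
  \<comment> \<open>Invertibility does not state the size of \<open>B\<close>; comparing column
    counts in the two products fixes it.\<close>
  have Bc: "B \<in> carrier_mat s s"
    using A arg_cong[OF B(1), of dim_col] arg_cong[OF B(2), of dim_col] by auto
  have "transpose_mat A *\<^sub>v (transpose_mat B *\<^sub>v y) = transpose_mat (B * A) *\<^sub>v y"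
    using A Bc assms(2) by (simp add: transpose_mult[OF Bc A] assoc_mult_mat_vec[of _ s s _ s])
  then have "transpose_mat A *\<^sub>v (transpose_mat B *\<^sub>v y) = y" using B Bc assms(2) by simp
  then show thesis using that Bc assms(2) by (metis mult_mat_vec_carrier transpose_carrier_mat)
qed

lemma GL_transpose_injective:
  assumes "A \<in> GL s" "x \<in> carrier_vec s" "transpose_mat A *\<^sub>v x = 0\<^sub>v s"
  shows "x = 0\<^sub>v s"
proof -
  obtain B where A: "A \<in> carrier_mat s s" and B: "A * B = 1\<^sub>m (dim_row A)" "B * A = 1\<^sub>m (dim_row B)"
    using assms by (auto simp: GL_def invertible_mat_def inverts_mat_def)
  have Bc: "B \<in> carrier_mat s s"
    using A arg_cong[OF B(1), of dim_col] arg_cong[OF B(2), of dim_col] by auto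
  have "x = transpose_mat (A * B) *\<^sub>v x" using A B assms(2) by simp
  also have "\<dots> = transpose_mat B *\<^sub>v (transpose_mat A *\<^sub>v x)"
    using A Bc assms(2) by (simp add: transpose_mult[OF A Bc] assoc_mult_mat_vec[of _ s s _ s])
  also have "\<dots> = 0\<^sub>v s" using Bc by (auto simp: assms(3))
  finally show ?thesis .
qed

definition grl_tail :: "nat \<Rightarrow> 'a::field mat \<Rightarrow> 'a poly \<Rightarrow> 'a vec" where
  "grl_tail k A f = transpose_mat A *\<^sub>v vec (dim_row A) (\<lambda>j. coeff f (k - dim_row A + j))"

text \<open>A codeword as a function of its polynomial, so that conditions on words of the hull
  become conditions on polynomials.\<close>

definition grl_word :: "nat \<Rightarrow> 'a::field vec \<Rightarrow> 'a vec \<Rightarrow> 'a mat \<Rightarrow> 'a poly \<Rightarrow> 'a vec" where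
  "grl_word k a v A f = vec (dim_vec a) (\<lambda>i. v $ i * poly f (a $ i)) @\<^sub>v grl_tail k A f"

lemma GRL_eq: "GRL k a v A = grl_word k a v A ` {f. degree f < k}"
  unfolding GRL_def grl_word_def grl_tail_def by auto

lemma grl_tail_carrier: "A \<in> carrier_mat s s \<Longrightarrow> grl_tail k A f \<in> carrier_vec s"
  by (auto simp: grl_tail_def)

lemma grl_tail_linear:
  assumes "A \<in> carrier_mat s s"
  shows "grl_tail k A (f + g) = grl_tail k A f + grl_tail k A g"
    and "grl_tail k A (Polynomial.smult c f) = c \<cdot>\<^sub>v grl_tail k A f"
proof -
  let ?t = "\<lambda>f. vec s (\<lambda>j. coeff f (k - s + j))"
  have "?t (f + g) = ?t f + ?t g" by auto
  then show "grl_tail k A (f + g) = grl_tail k A f + grl_tail k A g"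
    using assms by (simp add: grl_tail_def mult_add_distrib_mat_vec[of _ s s])
  have "?t (Polynomial.smult c f) = c \<cdot>\<^sub>v ?t f" by auto
  then show "grl_tail k A (Polynomial.smult c f) = c \<cdot>\<^sub>v grl_tail k A f"
    using assms by (simp add: grl_tail_def mult_mat_vec[of _ s s])
qed

lemma grl_word_carrier:
  "A \<in> carrier_mat s s \<Longrightarrow> grl_word k a v A f \<in> carrier_vec (dim_vec a + s)"
  by (simp add: grl_word_def grl_tail_carrier)

lemma grl_word_linear:
  assumes A: "A \<in> carrier_mat s s"
  shows "grl_word k a v A (f + g) = grl_word k a v A f + grl_word k a v A g"
    and "grl_word k a v A (Polynomial.smult c f) = c \<cdot>\<^sub>v grl_word k a v A f"
  using grl_tail_carrier[OF A, of k f] grl_tail_carrier[OF A, of k g]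
  by (auto simp: grl_word_def grl_tail_linear[OF A] algebra_simps)

lemma poly_as_sum_of_monoms_less:
  assumes "\<forall>i\<ge>m. coeff f i = 0"
  shows "(\<Sum>i<m. monom (coeff f i) i) = f"
  using assms by (intro poly_eqI) (auto simp: coeff_sum)

text \<open>A multiple \<open>M * f\<close> in this set has fewer than \<open>n\<close> as degree
  bound, so its values at the \<open>n\<close> distinct points, scaled by nonzero
  \<open>v $ i\<close>, determine it. \<open>M = 1\<close> gives the code, and a product of linear
  factors gives the hull. The coefficient condition, unlike \<open>degree f < m\<close>, also covers
  \<open>m = 0\<close>, where only the zero polynomial is left.\<close>

lemma grl_word_image_subspace_dim:
  assumes params: "GRL_params n s k a v A" and M: "M \<noteq> 0" "degree M + m \<le> k"
  defines "C \<equiv> (\<lambda>f. grl_word k a v A (M * f)) ` {f. \<forall>i\<ge>m. coeff f i = 0}"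
  shows "VectorSpace.subspace class_ring C (module_vec TYPE('a::field) (n + s))"
    and "code_dim (n + s) C = m"
proof -
  define P where "P w = (\<Sum>i<m. monom (w $ i) i)" for w :: "'a vec"
  define T where "T w = grl_word k a v A (M * P w)" for w
  have A: "A \<in> carrier_mat s s" and n: "dim_vec a = n" "k \<le> n"
    and a: "inj_on (\<lambda>i. a $ i) {..<n}" and v: "\<forall>i<n. v $ i \<noteq> 0"
    using params by (auto simp: GRL_params_def GL_def)
  have coeff_P: "coeff (P w) j = (if j < m then w $ j else 0)" for w j
    by (auto simp: P_def coeff_sum)
  have C: "C = T ` carrier_vec m"
  proof -
    have "{f. \<forall>i\<ge>m. coeff f i = 0} = P ` carrier_vec m"
    proof safe
      fix f :: "'a poly" assume "\<forall>i\<ge>m. coeff f i = 0"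
      then have "f = P (vec m (coeff f))"
        by (simp add: P_def poly_as_sum_of_monoms_less)
      then show "f \<in> P ` carrier_vec m" by (rule image_eqI) simp
    qed (simp add: coeff_P)
    then show ?thesis unfolding C_def T_def by (simp add: image_image)
  qed
  have T1: "T (x + y) = T x + T y" if "x \<in> carrier_vec m" "y \<in> carrier_vec m" for x y
  proof -
    have "P (x + y) = P x + P y" using that by (intro poly_eqI) (auto simp: coeff_P)
    then show ?thesis by (simp add: T_def distrib_left grl_word_linear[OF A])
  qed
  have T2: "T (c \<cdot>\<^sub>v x) = c \<cdot>\<^sub>v T x" if "x \<in> carrier_vec m" for c x
  proof -
    have "P (c \<cdot>\<^sub>v x) = Polynomial.smult c (P x)" using that by (intro poly_eqI) (auto simp: coeff_P)
    then show ?thesis by (simp add: T_def grl_word_linear[OF A])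
  qed
  have T3: "inj_on T (carrier_vec m)"
  proof (rule inj_onI)
    fix x y assume xy: "x \<in> carrier_vec m" "y \<in> carrier_vec m" "T x = T y"
    have deg: "degree (M * P w) < n \<or> m = 0" for w
    proof (cases "m = 0")
      case False
      then have "degree (P w) < m" by (intro degree_lessI) (auto simp: coeff_P)
      then show ?thesis using degree_mult_le[of M "P w"] M n by linarith
    qed simp
    show "x = y"
    proof (cases "m = 0")
      case False
      have "poly (M * P x) (a $ i) = poly (M * P y) (a $ i)" if "i < n" for i
      proof -
        have "T x $ i = T y $ i" using xy by simp
        then show ?thesis using that v n by (simp add: T_def grl_word_def del: poly_mult)
      qed
      moreover have "card ((\<lambda>i. a $ i) ` {..<n}) = n" using a by (simp add: card_image)
      ultimately have "M * P x = M * P y"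
        using deg False by (intro poly_eqI_degree[of "(\<lambda>i. a $ i) ` {..<n}"]) auto
      then have "P x = P y" using M by simp
      then have "x $ j = y $ j" if "j < m" for j
        using that coeff_P[of x j] coeff_P[of y j] by simp
      then show ?thesis using xy by auto
    qed (use xy in auto)
  qed
  have T4: "T x \<in> carrier_vec (n + s)" for x
    unfolding T_def using grl_word_carrier[OF A, of k a] n by simp
  show "VectorSpace.subspace class_ring C (module_vec TYPE('a) (n + s))" "code_dim (n + s) C = m"
    unfolding C using injective_image_subspace_dim[OF T4 T1 T2 T3] by blast+
qed

lemma galois_inner_append:
  fixes x y x' y' :: "'a::field vec"
  assumes "dim_vec x = dim_vec y" "dim_vec x' = dim_vec y'"
  shows "galois_inner p l (x @\<^sub>v x') (y @\<^sub>v y') = galois_inner p l x y + galois_inner p l x' y'"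
proof -
  have split: "(\<Sum>i<m + n. f i) = (\<Sum>i<m. f i) + (\<Sum>i<n. f (m + i))"
    for f :: "nat \<Rightarrow> 'a" and m n
    by (induction n) (simp_all add: add.assoc)
  show ?thesis using assms by (simp add: galois_inner_def split)
qed

section \<open>The hull\<close>

text \<open>If the evaluation part of the form is diagonal in the evaluations at the
  \<open>z i\<close>, suitable test polynomials \<open>g\<close> isolate each
  \<open>poly f (z i)\<close> and then each tail coordinate. So \<open>f\<close> gives a hull word
  exactly when all of these vanish, that is, when \<open>f\<close> is a multiple of the product of
  the \<open>[:- z i, 1:]\<close> of degree below \<open>k - s\<close>, or zero.\<close>

lemma galois_hull_GRL_diagonal:
  fixes z \<gamma> :: "nat \<Rightarrow> 'a::field"
  assumes params: "GRL_params n s k a v A" and m: "m + s \<le> k"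
    and z: "inj_on z {..<m}" and \<gamma>: "\<forall>i<m. \<gamma> i \<noteq> 0"
    and diag: "\<And>g f. degree g < k \<Longrightarrow> degree f < k \<Longrightarrow>
      (\<Sum>i<n. v $ i * poly g (a $ i) * (v $ i * poly f (a $ i)) ^ (p ^ l))
      = (\<Sum>i<m. \<gamma> i * poly g (z i) * poly f (z i) ^ (p ^ l))"
    and p: "p > 0"
  shows "galois_hull p l (n + s) (GRL k a v A)
    = (\<lambda>f. grl_word k a v A ((\<Prod>i<m. [:- z i, 1:]) * f)) `
        {f. \<forall>i\<ge>k - s - m. coeff f i = 0}" (is "_ = ?H")
proof -
  let ?r = "p ^ l" and ?M = "\<Prod>i<m. [:- z i, 1:]"
  have A: "A \<in> carrier_mat s s" and GL: "A \<in> GL s" and n: "dim_vec a = n" and s: "1 \<le> s" "s \<le> k"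
    using params by (auto simp: GRL_params_def GL_def)
  have dimA: "dim_row A = s" using A by simp
  have inner: "galois_inner p l (grl_word k a v A g) (grl_word k a v A f)
      = (\<Sum>i<m. \<gamma> i * poly g (z i) * poly f (z i) ^ ?r)
        + (\<Sum>j<s. grl_tail k A g $ j * (grl_tail k A f $ j) ^ ?r)"
    if "degree g < k" "degree f < k" for g f
    using diag[OF that] grl_tail_carrier[OF A, of k g] grl_tail_carrier[OF A, of k f]
    by (simp add: grl_word_def galois_inner_append) (simp add: galois_inner_def n)
  have tail0: "grl_tail k A f = 0\<^sub>v s" if "\<forall>i\<ge>k - s. coeff f i = 0" for f
  proof -
    have "vec s (\<lambda>j. coeff f (k - s + j)) = 0\<^sub>v s" using that by auto
    then show ?thesis unfolding grl_tail_def dimA using A by auto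
  qed
  \<comment> \<open>The exponent must be positive here, since \<open>0 ^ 0 = 1\<close>.\<close>
  have r0: "(0::'a) ^ ?r = 0" using p by simp
  show ?thesis
  proof (intro equalityI subsetI)
    fix x assume "x \<in> galois_hull p l (n + s) (GRL k a v A)"
    then obtain f where f: "degree f < k" "x = grl_word k a v A f"
      and dual: "\<And>g. degree g < k \<Longrightarrow> galois_inner p l (grl_word k a v A g) x = 0"
      by (auto simp: galois_hull_def galois_dual_def GRL_eq)
    have eval0: "poly f (z i) = 0" if i: "i < m" for i
    proof -
      \<comment> \<open>This test polynomial vanishes at every \<open>z j\<close> except
        \<open>z i\<close>, and its degree \<open>m - 1\<close> is below \<open>k - s\<close>, so
        its tail is zero.\<close>
      let ?g = "\<Prod>j\<in>{..<m} - {i}. [:- z j, 1:]"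
      have deg: "degree ?g < k - s" using i m by (auto simp: degree_prod_linear)
      then have "\<forall>i\<ge>k - s. coeff ?g i = 0" by (auto intro: coeff_eq_0)
      then have "(\<Sum>j<m. \<gamma> j * poly ?g (z j) * poly f (z j) ^ ?r) = 0"
        using dual[of ?g] deg inner[of ?g f] f tail0[of ?g] by auto
      also have "(\<Sum>j<m. \<gamma> j * poly ?g (z j) * poly f (z j) ^ ?r)
          = (\<Sum>j<m. if j = i then \<gamma> i * poly ?g (z i) * poly f (z i) ^ ?r else 0)"
        by (intro sum.cong) (auto simp: poly_prod)
      finally have "\<gamma> i * poly ?g (z i) * poly f (z i) ^ ?r = 0" using i by simp
      moreover have "poly ?g (z i) \<noteq> 0"
        using i z by (auto simp: poly_prod inj_on_def)
      ultimately show ?thesis using \<gamma> i by auto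
    qed
    have "grl_tail k A f $ i = 0" if i: "i < s" for i
    proof -
      \<comment> \<open>Invertibility of \<open>A\<close> allows a test polynomial with tail
        \<open>unit_vec s i\<close>. Its own evaluations need no control, as those of
        \<open>f\<close> are already known to vanish.\<close>
      obtain y where y: "y \<in> carrier_vec s" "transpose_mat A *\<^sub>v y = unit_vec s i"
        using GL_transpose_solvable[OF GL unit_vec_carrier] by blast
      let ?g = "\<Sum>j<s. monom (y $ j) (k - s + j)"
      have "degree ?g < k"
        using s by (intro degree_sum_less le_less_trans[OF degree_monom_le]) auto
      moreover have "grl_tail k A ?g = unit_vec s i"
      proof -
        have "vec s (\<lambda>j. coeff ?g (k - s + j)) = y"
          using y by (auto simp: coeff_sum)
        then show ?thesis using y by (simp add: grl_tail_def dimA)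
      qed
      ultimately have "(\<Sum>j<s. unit_vec s i $ j * (grl_tail k A f $ j) ^ ?r) = 0"
        using dual[of ?g] inner[of ?g f] f eval0 r0 by simp
      also have "(\<Sum>j<s. unit_vec s i $ j * (grl_tail k A f $ j) ^ ?r)
          = (\<Sum>j<s. if j = i then (grl_tail k A f $ i) ^ ?r else 0)"
        using i by (intro sum.cong) auto
      finally show ?thesis using i by simp
    qed
    then have "grl_tail k A f = 0\<^sub>v s" using grl_tail_carrier[OF A, of k f] by auto
    then have "vec s (\<lambda>j. coeff f (k - s + j)) = 0\<^sub>v s"
      using GL_transpose_injective[OF GL] by (simp add: grl_tail_def dimA)
    then have top: "coeff f (k - s + j) = 0" if "j < s" for j
      using that by (metis index_vec index_zero_vec(1))
    obtain q where q: "f = ?M * q"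
      using prod_linear_dvd[OF _ z, of f] eval0 by (auto simp: dvd_def)
    have "\<forall>i\<ge>k - s - m. coeff q i = 0"
    proof (cases "q = 0")
      \<comment> \<open>The leading coefficient of \<open>f\<close> is nonzero while the top
        \<open>s\<close> coefficients vanish, so \<open>f\<close> has degree below
        \<open>k - s\<close>, and dividing by \<open>?M\<close> lowers the degree by exactly
        \<open>m\<close>.\<close>
      case False
      have M: "?M \<noteq> 0" by auto
      then have deg: "degree f = m + degree q"
        using False by (simp add: q degree_mult_eq degree_prod_linear)
      have "coeff f (degree f) \<noteq> 0" using False M q by (simp add: leading_coeff_0_iff)
      moreover have "coeff f (degree f) = 0" if "k - s \<le> degree f"
        using top[of "degree f - (k - s)"] that f(1) s by simp
      ultimately have "degree f < k - s" by (meson not_le)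
      then show ?thesis using deg by (auto intro!: coeff_eq_0)
    qed simp
    then show "x \<in> ?H" using f q by blast
  next
    fix x assume "x \<in> ?H"
    then obtain f where f: "\<forall>i\<ge>k - s - m. coeff f i = 0"
      and x: "x = grl_word k a v A (?M * f)" by blast
    have c: "coeff (?M * f) i = 0" if "i \<ge> k - s" for i
    proof (cases "f = 0")
      case False
      then have "degree f < k - s - m" using f by (metis leading_coeff_0_iff not_le)
      then have "degree (?M * f) < k - s"
        using degree_mult_le[of ?M f] by (simp add: degree_prod_linear)
      then show ?thesis using that by (intro coeff_eq_0) simp
    qed simp
    then have deg: "degree (?M * f) < k" using s by (intro degree_lessI) auto
    have "poly (?M * f) (z i) = 0" if "i < m" for i using that by (auto simp: poly_prod)
    then have "galois_inner p l (grl_word k a v A g) x = 0" if "degree g < k" for g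
      using inner[OF that deg] tail0[of "?M * f"] c r0 by (simp add: x del: poly_mult)
    then show "x \<in> galois_hull p l (n + s) (GRL k a v A)"
      using deg grl_word_carrier[OF A, of k a v] n
      by (auto simp: galois_hull_def galois_dual_def GRL_eq x)
  qed
qed

section \<open>Choice of the multipliers and the dimension of the hull\<close>

lemma pred_mult_less_of_le_div:
  assumes "k \<le> (n + r) div (r + 1)" "k \<ge> 1"
  shows "(k - 1) * (r + 1) < (n::nat)"
proof -
  have "k * (r + 1) \<le> n + r"
    using assms(1) by (metis div_times_less_eq_dividend mult_le_mono1 order_trans)
  moreover have "k * (r + 1) = (k - 1) * (r + 1) + (r + 1)" using assms(2) by (cases k) auto
  ultimately show ?thesis by linarith
qed

text \<open>The field with \<open>p ^ l\<close> elements appears as a subset \<open>K\<close> of the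
  field type; a finite field has only one subfield of a given order, so \<open>K\<close> is no extra
  choice.\<close>

theorem mainTheorem1:
  fixes p e l n s k h :: nat
    and a :: "'a::{field,finite} vec"
    and A :: "'a mat"
    and K :: "'a set"
  assumes "prime p"
    and "card (UNIV :: 'a set) = p ^ e"
    and "p ^ e > 4"
    and "l > 0"
    and "2 * l dvd e"
    and "subfield K class_ring"
    and "card K = p ^ l"
    and "a \<in> carrier_vec n"
    and "inj_on (\<lambda>i. a $ i) {..<n}"
    and "\<forall>i<n. a $ i \<noteq> 0"
    and "\<forall>i<n. inverse (a $ i) * lagrange_u a i \<in> K - {0}"
    and "s \<ge> 1"
    and "A \<in> GL s"
    and "s + 1 \<le> k"
    and "k \<le> (n + p ^ l) div (p ^ l + 1)"
    and "h \<le> k - s - 1"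
  shows "\<exists>v C. GRL_params n s k a v A \<and> C = GRL k a v A \<and>
           linear_code (n + s) k C \<and>
           code_dim (n + s) (galois_hull p l (n + s) C) = h"
proof -
  let ?r = "p ^ l" and ?q = "card (UNIV :: 'a set)"
  \<comment> \<open>The number of multipliers to perturb: each adds one evaluation condition to
    those at 0 and on the top \<open>s\<close> coefficients.\<close>
  define t where "t = k - s - 1 - h"
  have n: "dim_vec a = n" using assms by simp
  have r: "?r > 1" using \<open>prime p\<close> \<open>l > 0\<close> by (metis one_less_power prime_gt_1_nat)
  have dvd: "(?r - 1) * (?r + 1) dvd ?q - 1"
    unfolding assms(2) by (rule square_minus_one_dvd_power) fact
  \<comment> \<open>The bound on \<open>k\<close> in the form used for degrees:
    \<open>g * f ^ ?r\<close> has degree below \<open>n\<close>.\<close>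
  have kn: "(k - 1) * (?r + 1) < n" by (rule pred_mult_less_of_le_div) (use assms in auto)
  moreover have "k - 1 \<le> (k - 1) * (?r + 1)" by simp
  ultimately have "k \<le> n" by linarith
  have "\<exists>w. w \<noteq> 0 \<and> w ^ (?r + 1) = inverse (a $ i) * lagrange_u a i" if "i < n" for i
    using ex_root_of_subfield_element[OF assms(6), of "inverse (a $ i) * lagrange_u a i"]
      dvd r assms(11) that unfolding assms(7) by auto
  then obtain w where w: "\<And>i. i < n \<Longrightarrow> w i \<noteq> 0 \<and> w i ^ (?r + 1) = inverse (a $ i) * lagrange_u a i"
    by metis
  obtain \<alpha> :: 'a where \<alpha>: "\<alpha> \<noteq> 0" "\<alpha> ^ (?r + 1) \<noteq> 1"
  proof -
    obtain g :: 'a where g: "g \<noteq> 0" "\<And>i. g ^ i = 1 \<longleftrightarrow> ?q - 1 dvd i"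
      using finite_field_generator by blast
    \<comment> \<open>Otherwise \<open>(?r - 1) * (?r + 1)\<close>, a divisor of
      \<open>?q - 1\<close>, would divide \<open>?r + 1\<close>, forcing \<open>?r = 2\<close> and
      then \<open>?q \<le> 4\<close>. So a generator can serve as \<open>\<alpha>\<close>.\<close>
    have "\<not> ?q - 1 dvd ?r + 1"
    proof
      assume q: "?q - 1 dvd ?r + 1"
      then have "(?r - 1) * (?r + 1) \<le> 1 * (?r + 1)"
        using dvd_imp_le[OF dvd_trans[OF dvd q]] by simp
      then have "?r - 1 \<le> 1" unfolding mult_le_cancel2 by simp
      then have "?r = 2" using r by linarith
      then have "?q - 1 \<le> 3" using q by (auto dest: dvd_imp_le)
      then show False using assms(2,3) by simp
    qed
    then show thesis using g that by blast
  qed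
  define v where "v = vec n (\<lambda>i. if i < t then \<alpha> * w i else w i)"
  have params: "GRL_params n s k a v A"
    using assms \<open>k \<le> n\<close> w \<alpha> by (auto simp: GRL_params_def v_def)
  define c where "c = - inverse (\<Prod>i<n. - (a $ i))"
  have c: "c \<noteq> 0" using assms(10) by (auto simp: c_def)
  \<comment> \<open>Index 0 is the point 0 and index \<open>i + 1\<close> is \<open>a $ i\<close>;
    they are distinct because no \<open>a $ i\<close> is 0.\<close>
  define z where "z i = (case i of 0 \<Rightarrow> 0 | Suc i \<Rightarrow> a $ i)" for i
  define \<gamma> where "\<gamma> i = (case i of 0 \<Rightarrow> c
    | Suc i \<Rightarrow> (\<alpha> ^ (?r + 1) - 1) * (inverse (a $ i) * lagrange_u a i))" for i
  have tk: "Suc t + s + h = k" using assms by (simp add: t_def)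
  have tn: "t < n" using tk \<open>k \<le> n\<close> by simp
  have z: "inj_on z {..<Suc t}"
    using assms(9,10) tn by (auto simp: z_def inj_on_def split: nat.splits) 
  have \<gamma>: "\<forall>i<Suc t. \<gamma> i \<noteq> 0"
    using c \<alpha> assms(11) tn by (auto simp: \<gamma>_def split: nat.splits)
  have diag: "(\<Sum>i<n. v $ i * poly g (a $ i) * (v $ i * poly f (a $ i)) ^ ?r)
      = (\<Sum>i<Suc t. \<gamma> i * poly g (z i) * poly f (z i) ^ ?r)"
    if "degree g < k" "degree f < k" for g f
  proof -
    let ?P = "g * f ^ ?r"
    define d where "d i = inverse (a $ i) * lagrange_u a i" for i
    have "degree ?P \<le> degree g + degree f * ?r"
      using degree_mult_le[of g "f ^ ?r"] degree_power_le[of f ?r] by linarith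
    also have "\<dots> \<le> (k - 1) + (k - 1) * ?r" using that by (intro add_mono mult_le_mono1) auto
    also have "\<dots> < n" using kn by simp
    finally have P: "degree ?P < n" .
    \<comment> \<open>The weight \<open>v $ i ^ (?r + 1)\<close> is \<open>d i\<close> plus a
      surplus for \<open>i < t\<close>. Interpolation collapses the \<open>d i\<close> part to the
      point 0, and the surplus supplies the other \<open>t\<close> diagonal terms.\<close>
    have "(\<Sum>i<n. v $ i * poly g (a $ i) * (v $ i * poly f (a $ i)) ^ ?r)
        = (\<Sum>i<n. d i * poly ?P (a $ i) + (if i < t then (\<alpha> ^ (?r + 1) - 1) * d i * poly ?P (a $ i) else 0))"
    proof (rule sum.cong)
      fix i assume "i \<in> {..<n}"
      then have "i < n" by simp
      have "v $ i * poly g (a $ i) * (v $ i * poly f (a $ i)) ^ ?r = v $ i ^ (?r + 1) * poly ?P (a $ i)"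
        by (simp add: power_mult_distrib)
      also have "v $ i ^ (?r + 1) = (if i < t then \<alpha> ^ (?r + 1) * d i else d i)"
        using w[OF \<open>i < n\<close>] \<open>i < n\<close> by (simp add: v_def d_def power_mult_distrib del: power_Suc)
      finally show "v $ i * poly g (a $ i) * (v $ i * poly f (a $ i)) ^ ?r
          = d i * poly ?P (a $ i) + (if i < t then (\<alpha> ^ (?r + 1) - 1) * d i * poly ?P (a $ i) else 0)"
        by (auto simp: algebra_simps)
    qed simp
    also have "\<dots> = (\<Sum>i<n. d i * poly ?P (a $ i)) + (\<Sum>i<t. (\<alpha> ^ (?r + 1) - 1) * d i * poly ?P (a $ i))"
    proof -
      have "{..<n} \<inter> {i. i < t} = {..<t}" using tn by auto
      then show ?thesis by (simp add: sum.distrib sum.If_cases)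
    qed
    also have "(\<Sum>i<n. d i * poly ?P (a $ i)) = c * poly ?P 0"
      using sum_lagrange_u_div[of a ?P] assms(9,10) P by (simp add: n d_def c_def)
    also have "c * poly ?P 0 + (\<Sum>i<t. (\<alpha> ^ (?r + 1) - 1) * d i * poly ?P (a $ i))
        = (\<Sum>i<Suc t. \<gamma> i * poly g (z i) * poly f (z i) ^ ?r)"
      unfolding sum.lessThan_Suc_shift
      by (simp add: \<gamma>_def z_def d_def mult.assoc)
    finally show ?thesis .
  qed
  have "GRL k a v A = (\<lambda>f. grl_word k a v A (1 * f)) ` {f. \<forall>i\<ge>k. coeff f i = 0}"
  proof -
    \<comment> \<open>This needs \<open>k > 0\<close>, since the zero polynomial has degree
      0.\<close>
    have "{f :: 'a poly. degree f < k} = {f. \<forall>i\<ge>k. coeff f i = 0}"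
      using assms(14) by (auto intro: coeff_eq_0 degree_lessI)
    then show ?thesis by (simp add: GRL_eq)
  qed
  then have lin: "linear_code (n + s) k (GRL k a v A)"
    using grl_word_image_subspace_dim[OF params, of 1 k] by (simp add: linear_code_def)
  have "galois_hull p l (n + s) (GRL k a v A)
      = (\<lambda>f. grl_word k a v A ((\<Prod>i<Suc t. [:- z i, 1:]) * f)) `
          {f. \<forall>i\<ge>k - s - Suc t. coeff f i = 0}"
    by (rule galois_hull_GRL_diagonal[OF params _ z \<gamma> diag])
      (use tk \<open>prime p\<close> prime_gt_0_nat in auto)
  moreover have "k - s - Suc t = h" using tk by simp
  moreover have "degree (\<Prod>i<Suc t. [:- z i, 1:]) = Suc t" unfolding degree_prod_linear by simp
  moreover have "(\<Prod>i<Suc t. [:- z i, 1:]) \<noteq> 0" by (simp del: prod.lessThan_Suc)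
  ultimately have "code_dim (n + s) (galois_hull p l (n + s) (GRL k a v A)) = h"
    using grl_word_image_subspace_dim(2)[OF params, of "\<Prod>i<Suc t. [:- z i, 1:]" h] tk by simp
  with params lin show ?thesis by blast
qed

end
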